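(* Let $G$ be a Hausdorff topological group with identity $e$. Then $G$ is $\omega$-narrow and a strong $q$-space if and only if for each open neighborhood $O$ of $e$ in $G$ there is a closed sequentially compact invariant subgroup $H$ of $G$ which is of countable character $\{V_n:n\in\omega\}$ in $G$, such that $H\subseteq O$, $\{V_n:n\in\omega\}$ is a strong $q$-sequence in $G$ at each $y\in H$, the canonical quotient mapping $p:G\rightarrow G/H$ is strongly sequential-perfect, and the quotient group $G/H$ is separable and metrizable.
   Context: All topological groups and spaces are assumed to be Hausdorff. "Invariant subgroup" means normal subgroup. For a subgroup $H$ of $G$, $G/H$ is the space of left cosets with the quotient topology, and $p:G\to G/H$ is the canonical quotient mapping. A topological group $G$ is $\omega$-narrow if for every open neighbourhood $V$ of the identity there is a countable subset $A$ of $G$ such that $AV=G$. A space is sequentially compact if every sequence in it has a convergent subsequence; a subset is sequentially compact if it is so as a subspace. A sequence $\{U_n:n\in\omega\}$ of open neighborhoods of a point $x$ in a space $X$ is a strong $q$-sequence at $x$ if every sequence $\{x_n\}_{n\in\omega}$ of points of $X$ with $x_n\in U_n$ for each $n\in\omega$ has a subsequence converging in $X$. A point $x$ is a strong $q$-point of $X$ if there is a strong $q$-sequence at $x$. A space is a strong $q$-space if each of its points is a strong $q$-point. A subset $A$ of a space $X$ is of countable character $\{V_n:n\in\omega\}$ in $X$ if $\{V_n:n\in\omega\}$ is a countable family of open neighborhoods of $A$ (open sets containing $A$) such that each open neighborhood $U$ of $A$ contains some $V_n$. A continuous mapping $f:X\to Y$ is strongly sequential-perfect if $f$ is closed and $f^{-1}(F)$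 is a sequentially compact set for each sequentially compact set $F\subseteq Y$. *)

theory Defs
  imports "HOL-Analysis.Analysis" "HOL-Algebra.Coset" "HOL-Algebra.Left_Coset"
begin

section \<open>Sequential compactness and strong q-spaces\<close>

definition has_convergent_subseq :: "'a topology \<Rightarrow> (nat \<Rightarrow> 'a) \<Rightarrow> bool"
  where "has_convergent_subseq X s \<longleftrightarrow>
    (\<exists>l r. strict_mono (r :: nat \<Rightarrow> nat) \<and> limitin X (s \<circ> r) l sequentially)"

definition seq_compact_space :: "'a topology \<Rightarrow> bool"
  where "seq_compact_space X \<longleftrightarrow>
    (\<forall>s. range s \<subseteq> topspace X \<longrightarrow> has_convergent_subseq X s)"

definition seq_compactin :: "'a topology \<Rightarrow> 'a set \<Rightarrow> bool"
  where "seq_compactin X S \<longleftrightarrow> S \<subseteq> topspace X \<and> seq_compact_space (subtopology X S)"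

definition strong_q_sequence :: "'a topology \<Rightarrow> 'a \<Rightarrow> (nat \<Rightarrow> 'a set) \<Rightarrow> bool"
  where "strong_q_sequence X x U \<longleftrightarrow>
    (\<forall>n. openin X (U n) \<and> x \<in> U n) \<and>
    (\<forall>s. (\<forall>n. s n \<in> U n) \<longrightarrow> has_convergent_subseq X s)"

definition strong_q_point :: "'a topology \<Rightarrow> 'a \<Rightarrow> bool"
  where "strong_q_point X x \<longleftrightarrow> (\<exists>U. strong_q_sequence X x U)"

definition strong_q_space :: "'a topology \<Rightarrow> bool"
  where "strong_q_space X \<longleftrightarrow> (\<forall>x \<in> topspace X. strong_q_point X x)"

definition countable_character :: "'a topology \<Rightarrow> 'a set \<Rightarrow> (nat \<Rightarrow> 'a set) \<Rightarrow> bool"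
  where "countable_character X A V \<longleftrightarrow>
    (\<forall>n. openin X (V n) \<and> A \<subseteq> V n) \<and>
    (\<forall>U. openin X U \<and> A \<subseteq> U \<longrightarrow> (\<exists>n. V n \<subseteq> U))"

definition strongly_sequential_perfect_map :: "'a topology \<Rightarrow> 'b topology \<Rightarrow> ('a \<Rightarrow> 'b) \<Rightarrow> bool"
  where "strongly_sequential_perfect_map X Y f \<longleftrightarrow>
    continuous_map X Y f \<and> closed_map X Y f \<and>
    (\<forall>F. seq_compactin Y F \<longrightarrow> seq_compactin X {x \<in> topspace X. f x \<in> F})"

section \<open>Topological groups\<close>

text \<open>The Hausdorff condition is not part of the locale.\<close>

locale topological_group = group G for G :: "('a, 'b) monoid_scheme" (structure) +
  fixes T :: "'a topology"
  assumes topspace_eq_carrier: "topspace T = carrier G"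
    and continuous_mult: "continuous_map (prod_topology T T) T (\<lambda>(x, y). x \<otimes> y)"
    and continuous_inv: "continuous_map T T (\<lambda>x. inv x)"

definition omega_narrow :: "('a, 'b) monoid_scheme \<Rightarrow> 'a topology \<Rightarrow> bool"
  where "omega_narrow G T \<longleftrightarrow>
    (\<forall>V. openin T V \<and> \<one>\<^bsub>G\<^esub> \<in> V \<longrightarrow>
      (\<exists>A. countable A \<and> A \<subseteq> carrier G \<and> A <#>\<^bsub>G\<^esub> V = carrier G))"

definition coset_map :: "('a, 'b) monoid_scheme \<Rightarrow> 'a set \<Rightarrow> 'a \<Rightarrow> 'a set"
  where "coset_map G H x = x <#\<^bsub>G\<^esub> H"

text \<open>The finest topology on the left cosets making \<open>coset_map G H\<close> continuous.\<close>

definition coset_topology :: "('a, 'b) monoid_scheme \<Rightarrow> 'a topology \<Rightarrow> 'a set \<Rightarrow> 'a set topology"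
  where "coset_topology G T H = topology (\<lambda>U. U \<subseteq> lcosets\<^bsub>G\<^esub> H \<and>
    openin T {x \<in> topspace T. coset_map G H x \<in> U})"

lemma openin_coset_topology:
  "openin (coset_topology G T H) U \<longleftrightarrow>
    U \<subseteq> lcosets\<^bsub>G\<^esub> H \<and> openin T {x \<in> topspace T. coset_map G H x \<in> U}"
proof -
  let ?P = "\<lambda>U. {x \<in> topspace T. coset_map G H x \<in> U}"
  have int: "?P (A \<inter> B) = ?P A \<inter> ?P B" for A B by auto
  have un: "?P (\<Union>K) = \<Union>(?P ` K)" for K by auto
  have "istopology (\<lambda>U. U \<subseteq> lcosets\<^bsub>G\<^esub> H \<and> openin T (?P U))"
    unfolding istopology_def int un by (auto intro!: openin_Union)
  then show ?thesis
    by (simp add: coset_topology_def)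
qed

context topological_group
begin

lemma topspace_coset_topology: "topspace (coset_topology G T H) = lcosets H"
proof -
  have "{x \<in> topspace T. coset_map G H x \<in> lcosets H} = topspace T"
    by (auto simp: LCOSETS_def coset_map_def topspace_eq_carrier)
  then have "openin (coset_topology G T H) (lcosets H)"
    by (simp add: openin_coset_topology)
  then show ?thesis
    by (metis openin_coset_topology openin_subset openin_topspace subset_antisym)
qed

lemma quotient_map_coset_map: "quotient_map T (coset_topology G T H) (coset_map G H)"
  unfolding quotient_map_def topspace_coset_topology openin_coset_topology
  by (auto simp: LCOSETS_def coset_map_def topspace_eq_carrier)

lemma topspace_coset_topology_normal:
  assumes "H \<lhd> G"
  shows "topspace (coset_topology G T H) = carrier (G Mod H)"
  using normal.coset_eq[OF assms]
  by (simp add: topspace_coset_topology FactGroup_def LCOSETS_def RCOSETS_def)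

end

end

theory Submission
  imports Defs
begin

text \<open>
  Given a strong q-sequence \<open>U\<close> at the identity, \<open>\<omega>\<close>-narrowness makes countably many neighbourhoods
  suffice to contain all conjugates, so some sequence \<open>V\<close> of symmetric open neighbourhoods with
  \<open>V (Suc n)\<^sup>3 \<subseteq> V n\<close> refines \<open>W\<close> and all \<open>U n\<close> and has a normal subgroup as its intersection \<open>H\<close>.
  Any sequence with \<open>s n \<in> V n\<close> has a subsequence converging to a point of \<open>H\<close>; this single fact
  yields the countable character and sequential compactness of \<open>H\<close>, and from these the
  strong sequential perfectness of the quotient map. A Birkhoff--Kakutani norm built from \<open>V\<close>
  vanishes exactly on \<open>H\<close> and metrizes the quotient. Conversely, strong q-sequences can be
  translated, and a countable dense subset of \<open>G/H\<close> with \<open>H \<subseteq> O\<close> lifts to a countable \<open>A\<close> with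
  \<open>A O O\<^sup>-\<^sup>1 = G\<close>.
\<close>

section \<open>Neighbourhoods and left cosets\<close>

lemma (in group) mult_inv_cancel:
  "x \<in> carrier G \<Longrightarrow> y \<in> carrier G \<Longrightarrow> x \<otimes> (inv x \<otimes> y) = y"
  "x \<in> carrier G \<Longrightarrow> y \<in> carrier G \<Longrightarrow> inv x \<otimes> (x \<otimes> y) = y"
  by (simp_all add: m_assoc[symmetric])

context topological_group
begin

lemma openin_carrier_mem: "openin T U \<Longrightarrow> x \<in> U \<Longrightarrow> x \<in> carrier G"
  using openin_subset topspace_eq_carrier by blast

lemma continuous_map_mult:
  assumes "continuous_map X T f" "continuous_map X T g"
  shows "continuous_map X T (\<lambda>x. f x \<otimes> g x)"
proof -
  have "continuous_map X (prod_topology T T) (\<lambda>x. (f x, g x))"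
    using assms by (simp add: continuous_map_pairedI)
  from continuous_map_compose[OF this continuous_mult] show ?thesis
    by (simp add: o_def)
qed

lemma continuous_map_lmult: "x \<in> carrier G \<Longrightarrow> continuous_map T T (\<lambda>y. x \<otimes> y)"
  by (intro continuous_map_mult) (simp_all add: topspace_eq_carrier)

lemma continuous_map_rmult: "x \<in> carrier G \<Longrightarrow> continuous_map T T (\<lambda>y. y \<otimes> x)"
  by (intro continuous_map_mult) (simp_all add: topspace_eq_carrier)

lemma openin_preimage_carrier:
  assumes "continuous_map T T f" "openin T U"
  shows "openin T {y \<in> carrier G. f y \<in> U}"
  using openin_continuous_map_preimage[OF assms] by (simp add: topspace_eq_carrier)

lemma openin_l_coset:
  assumes "x \<in> carrier G" "openin T U"
  shows "openin T (x <# U)"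
proof -
  have "x <# U = {y \<in> carrier G. inv x \<otimes> y \<in> U}"
  proof (intro equalityI subsetI)
    fix y assume "y \<in> x <# U"
    then obtain u where "u \<in> U" "y = x \<otimes> u" by (auto simp: l_coset_def)
    then show "y \<in> {y \<in> carrier G. inv x \<otimes> y \<in> U}"
      using assms openin_carrier_mem by (auto simp: inv_solve_left m_assoc[symmetric])
  next
    fix y assume y: "y \<in> {y \<in> carrier G. inv x \<otimes> y \<in> U}"
    then have "y = x \<otimes> (inv x \<otimes> y)"
      using assms by (simp add: m_assoc[symmetric])
    then show "y \<in> x <# U" using y by (auto simp: l_coset_def)
  qed
  then show ?thesis
    using assms continuous_map_lmult openin_preimage_carrier by simp
qed

lemma mem_l_coset_one: "x \<in> carrier G \<Longrightarrow> \<one> \<in> U \<Longrightarrow> x \<in> x <# U"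
  unfolding l_coset_def by force

text \<open>Continuity of multiplication at the identity is used twice: \<open>B\<close> controls
  the first two factors and sends their product into \<open>A\<close>, while \<open>A\<close>
  controls the product with the third. Intersecting with the inverse image then gives
  symmetry.\<close>

lemma symmetric_nhd_cube:
  assumes U: "openin T U" "\<one> \<in> U"
  shows "\<exists>V. openin T V \<and> \<one> \<in> V \<and> (\<forall>x\<in>V. inv x \<in> V) \<and> V \<subseteq> U \<and>
    (\<forall>x\<in>V. \<forall>y\<in>V. \<forall>z\<in>V. x \<otimes> y \<otimes> z \<in> U)"
proof -
  have half: "\<exists>V. openin T V \<and> \<one> \<in> V \<and> (\<forall>x\<in>V. \<forall>y\<in>V. x \<otimes> y \<in> U)"
    if "openin T U" "\<one> \<in> U" for U
  proof -
    define P where "P = {z \<in> topspace (prod_topology T T). (case z of (x, y) \<Rightarrow> x \<otimes> y) \<in> U}"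
    have "openin (prod_topology T T) P"
      unfolding P_def using continuous_mult that(1) by (rule openin_continuous_map_preimage)
    moreover have "(\<one>, \<one>) \<in> P"
      using that topspace_eq_carrier by (simp add: P_def)
    ultimately have "\<exists>A B. openin T A \<and> openin T B \<and> \<one> \<in> A \<and> \<one> \<in> B \<and> A \<times> B \<subseteq> P"
      by (rule openin_prod_topology_alt[THEN iffD1, rule_format])
    then obtain A B where "openin T A" "openin T B" "\<one> \<in> A" "\<one> \<in> B" "A \<times> B \<subseteq> P"
      by blast
    then show ?thesis
      by (intro exI[of _ "A \<inter> B"]) (auto simp: P_def)
  qed
  obtain A where A: "openin T A" "\<one> \<in> A" "\<And>x y. x \<in> A \<Longrightarrow> y \<in> A \<Longrightarrow> x \<otimes> y \<in> U"
    using half[OF U] by blast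
  obtain B where B: "openin T B" "\<one> \<in> B" "\<And>x y. x \<in> B \<Longrightarrow> y \<in> B \<Longrightarrow> x \<otimes> y \<in> A"
    using half[OF A(1,2)] by blast
  define C where "C = A \<inter> B \<inter> U"
  define V where "V = C \<inter> {y \<in> carrier G. inv y \<in> C}"
  have C: "openin T C" "\<one> \<in> C" using A B U by (auto simp: C_def)
  show ?thesis
  proof (intro exI[of _ V] conjI ballI)
    show "openin T V"
      using C openin_preimage_carrier[OF continuous_inv] by (simp add: V_def openin_Int)
    show "\<one> \<in> V" using C by (simp add: V_def)
    show "V \<subseteq> U" by (auto simp: V_def C_def)
    show "inv x \<in> V" if "x \<in> V" for x
      using that by (auto simp: V_def)
    show "x \<otimes> y \<otimes> z \<in> U" if "x \<in> V" "y \<in> V" "z \<in> V" for x y z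
      using that A(3) B(3) by (auto simp: V_def C_def)
  qed
qed

section \<open>The coset map: its fibres and its openness\<close>

lemma coset_map_eq_iff:
  assumes "subgroup H G" "x \<in> carrier G" "y \<in> carrier G"
  shows "coset_map G H x = coset_map G H y \<longleftrightarrow> inv x \<otimes> y \<in> H"
proof
  assume "coset_map G H x = coset_map G H y"
  then have "y \<in> x <# H" using assms lcos_self[of y H] by (simp add: coset_map_def)
  then show "inv x \<otimes> y \<in> H"
    using subgroup.lcos_module_imp[OF assms(1) is_group assms(2)] by blast
next
  assume "inv x \<otimes> y \<in> H"
  then have "y \<in> x <# H"
    using subgroup.lcos_module_rev[OF assms(1) is_group assms(2,3)] by blast
  then show "coset_map G H x = coset_map G H y"
    using l_repr_independence assms by (simp add: coset_map_def)
qed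

text \<open>The saturation of \<open>U\<close> is the union of the translates of \<open>U\<close> by
  inverses of elements of \<open>H\<close>, each open because right translations are
  continuous.\<close>

lemma openin_coset_image:
  assumes H: "subgroup H G" and U: "openin T U"
  shows "openin (coset_topology G T H) (coset_map G H ` U)"
proof -
  have Uc: "U \<subseteq> carrier G" using openin_carrier_mem[OF U] by blast
  have "{x \<in> topspace T. coset_map G H x \<in> coset_map G H ` U} =
      (\<Union>h\<in>H. {x \<in> carrier G. x \<otimes> h \<in> U})"
  proof (intro equalityI subsetI)
    fix x assume "x \<in> {x \<in> topspace T. coset_map G H x \<in> coset_map G H ` U}"
    then obtain u where x: "x \<in> carrier G" and u: "u \<in> U" "coset_map G H x = coset_map G H u"
      by (auto simp: topspace_eq_carrier)
    then have "inv x \<otimes> u \<in> H" using Uc coset_map_eq_iff[OF H] by blast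
    moreover have "x \<otimes> (inv x \<otimes> u) = u" using x u Uc by (simp add: m_assoc[symmetric] subsetD)
    ultimately show "x \<in> (\<Union>h\<in>H. {x \<in> carrier G. x \<otimes> h \<in> U})" using x u by force
  next
    fix x assume "x \<in> (\<Union>h\<in>H. {x \<in> carrier G. x \<otimes> h \<in> U})"
    then obtain h where h: "h \<in> H" "x \<in> carrier G" "x \<otimes> h \<in> U" by blast
    then have "inv x \<otimes> (x \<otimes> h) = h"
      using subgroup.mem_carrier[OF H] by (simp add: m_assoc[symmetric])
    then have "coset_map G H x = coset_map G H (x \<otimes> h)"
      using coset_map_eq_iff[OF H] h subgroup.mem_carrier[OF H] by simp
    then show "x \<in> {x \<in> topspace T. coset_map G H x \<in> coset_map G H ` U}"
      using h by (auto simp: topspace_eq_carrier)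
  qed
  moreover have "openin T (\<Union>h\<in>H. {x \<in> carrier G. x \<otimes> h \<in> U})"
    using U H by (intro openin_Union) (auto intro!: openin_preimage_carrier continuous_map_rmult dest: subgroup.mem_carrier)
  moreover have "coset_map G H ` U \<subseteq> lcosets H"
    using Uc by (auto simp: LCOSETS_def coset_map_def)
  ultimately show ?thesis by (simp add: openin_coset_topology)
qed

text \<open>Left translation carries convergent subsequences to convergent subsequences, so a strong
  q-sequence at the identity provides one at every point.\<close>

lemma strong_q_sequence_translate:
  assumes q: "strong_q_sequence T \<one> U" and x: "x \<in> carrier G"
  shows "strong_q_sequence T x (\<lambda>n. x <# U n)"
  unfolding strong_q_sequence_def
proof (intro conjI allI impI)
  have U: "openin T (U n)" "\<one> \<in> U n" for n
    using q by (auto simp: strong_q_sequence_def)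
  show "openin T (x <# U n)" "x \<in> x <# U n" for n
    using U x openin_l_coset mem_l_coset_one by auto
  fix s assume "\<forall>n. s n \<in> x <# U n"
  then have "\<forall>n. \<exists>u. u \<in> U n \<and> s n = x \<otimes> u" by (auto simp: l_coset_def)
  then obtain u where u: "\<And>n. u n \<in> U n" "\<And>n. s n = x \<otimes> u n" by metis
  then obtain l r where lr: "strict_mono r" "limitin T (u \<circ> r) l sequentially"
    using q by (force simp: strong_q_sequence_def has_convergent_subseq_def)
  have "limitin T ((\<lambda>y. x \<otimes> y) \<circ> (u \<circ> r)) (x \<otimes> l) sequentially"
    using continuous_map_limit[OF continuous_map_lmult[OF x] lr(2)] .
  moreover have "(\<lambda>y. x \<otimes> y) \<circ> (u \<circ> r) = s \<circ> r" using u by auto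
  ultimately show "has_convergent_subseq T s"
    using lr(1) unfolding has_convergent_subseq_def by auto
qed

text \<open>Choose \<open>H\<close> inside a symmetric \<open>V\<close> whose cube lies in the given
  neighbourhood, and one representative for each coset in a countable dense set. Density puts the
  coset of some representative a into the image of \<open>y <# V\<close>; hence the product of a
  inverse and y lies in \<open>H\<close> times \<open>V\<close>, which the cube condition
  absorbs.\<close>

lemma omega_narrow_if_quotients_separable:
  assumes "\<And>W. openin T W \<Longrightarrow> \<one> \<in> W \<Longrightarrow>
    \<exists>H. subgroup H G \<and> H \<subseteq> W \<and> separable_space (coset_topology G T H)"
  shows "omega_narrow G T"
  unfolding omega_narrow_def
proof (intro allI impI)
  fix U assume "openin T U \<and> \<one> \<in> U"
  then have U: "openin T U" "\<one> \<in> U" by auto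
  obtain V where V: "openin T V" "\<one> \<in> V" "\<forall>x\<in>V. inv x \<in> V"
    "\<forall>x\<in>V. \<forall>y\<in>V. \<forall>z\<in>V. x \<otimes> y \<otimes> z \<in> U"
    using symmetric_nhd_cube[OF U] by auto
  obtain H where H: "subgroup H G" "H \<subseteq> V" "separable_space (coset_topology G T H)"
    using assms[OF V(1,2)] by blast
  then obtain C where C: "countable C" "C \<subseteq> lcosets H"
    "coset_topology G T H closure_of C = topspace (coset_topology G T H)"
    by (auto simp: separable_space_def topspace_coset_topology)
  have "\<forall>c\<in>C. \<exists>a. a \<in> carrier G \<and> coset_map G H a = c"
    using C(2) by (auto simp: LCOSETS_def coset_map_def)
  then obtain rep where rep: "\<And>c. c \<in> C \<Longrightarrow> rep c \<in> carrier G"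
      "\<And>c. c \<in> C \<Longrightarrow> coset_map G H (rep c) = c"
    by metis
  show "\<exists>A. countable A \<and> A \<subseteq> carrier G \<and> A <#> U = carrier G"
  proof (intro exI[of _ "rep ` C"] conjI)
    show "countable (rep ` C)" using C(1) by simp
    show sub: "rep ` C \<subseteq> carrier G" using rep by auto
    show "rep ` C <#> U = carrier G"
    proof (intro equalityI subsetI)
      show "y \<in> carrier G" if "y \<in> rep ` C <#> U" for y
        using that sub openin_carrier_mem U by (auto simp: set_mult_def)
      fix y assume y: "y \<in> carrier G"
      have "openin (coset_topology G T H) (coset_map G H ` (y <# V))"
        using openin_coset_image[OF H(1)] openin_l_coset[OF y V(1)] by blast
      moreover have "coset_map G H ` (y <# V) \<noteq> {}" using mem_l_coset_one[OF y V(2)] by blast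
      ultimately obtain c where c: "c \<in> C" "c \<in> coset_map G H ` (y <# V)"
        using C(3) unfolding dense_intersects_open by blast
      then obtain v where v: "v \<in> V" "coset_map G H (rep c) = coset_map G H (y \<otimes> v)"
        using rep by (auto simp: l_coset_def)
      have cc: "rep c \<in> carrier G" "v \<in> carrier G" using rep c openin_carrier_mem V v by auto
      then have "inv (rep c) \<otimes> (y \<otimes> v) \<in> H"
        using coset_map_eq_iff[OF H(1)] v y by simp
      \<comment> \<open>The cube condition is applied to two genuine factors, one from
        \<open>H\<close> and one from \<open>V\<close>; the identity fills the third place.\<close>
      then have "inv (rep c) \<otimes> (y \<otimes> v) \<otimes> inv v \<otimes> \<one> \<in> U"
        using V H v by blast
      then have "inv (rep c) \<otimes> y \<in> U" using cc y by (simp add: m_assoc)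
      moreover have "y = rep c \<otimes> (inv (rep c) \<otimes> y)" using cc y by (simp add: m_assoc[symmetric])
      ultimately show "y \<in> rep ` C <#> U" using c(1) unfolding set_mult_def by blast
    qed
  qed
qed

text \<open>If \<open>G = A V\<close> with \<open>A\<close> countable and \<open>V\<close> symmetric, every \<open>x\<close> has the form \<open>v\<^sup>-\<^sup>1 a\<^sup>-\<^sup>1\<close>,
  and conjugation by it sends \<open>a V a\<^sup>-\<^sup>1\<close> into \<open>V V V\<close>.\<close>

lemma omega_narrow_countable_conjugates:
  assumes n: "omega_narrow G T" and U: "openin T U" "\<one> \<in> U"
  shows "\<exists>\<gamma>. countable \<gamma> \<and> (\<forall>V\<in>\<gamma>. openin T V \<and> \<one> \<in> V) \<and>
    (\<forall>x\<in>carrier G. \<exists>V\<in>\<gamma>. \<forall>v\<in>V. x \<otimes> v \<otimes> inv x \<in> U)"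
proof -
  obtain V where V: "openin T V" "\<one> \<in> V" "\<forall>x\<in>V. inv x \<in> V"
    "\<forall>x\<in>V. \<forall>y\<in>V. \<forall>z\<in>V. x \<otimes> y \<otimes> z \<in> U"
    using symmetric_nhd_cube[OF U] by auto
  obtain A where A: "countable A" "A \<subseteq> carrier G" "A <#> V = carrier G"
    using n[unfolded omega_narrow_def, rule_format, of V] V(1,2) by auto
  define W where "W a = {y \<in> carrier G. inv a \<otimes> y \<otimes> a \<in> V}" for a
  show ?thesis
  proof (intro exI[of _ "W ` A"] conjI ballI)
    show "countable (W ` A)" using A by simp
    show "openin T B" "\<one> \<in> B" if B: "B \<in> W ` A" for B
    proof -
      obtain a where a: "a \<in> A" "B = W a" "a \<in> carrier G" using B A by blast
      have "continuous_map T T (\<lambda>y. inv a \<otimes> y \<otimes> a)"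
        using a by (intro continuous_map_mult) (simp_all add: topspace_eq_carrier)
      from openin_preimage_carrier[OF this V(1)] show "openin T B" "\<one> \<in> B"
        using a V(2) by (simp_all add: W_def)
    qed
    fix x assume x: "x \<in> carrier G"
    then have "inv x \<in> A <#> V" using A by simp
    then obtain a v where av: "a \<in> A" "v \<in> V" "inv x = a \<otimes> v" by (auto simp: set_mult_def)
    have c: "a \<in> carrier G" "v \<in> carrier G" using av A V openin_carrier_mem by auto
    have xe: "x = inv v \<otimes> inv a" using av(3) c x by (metis inv_inv inv_mult_group)
    have "x \<otimes> w \<otimes> inv x \<in> U" if "w \<in> W a" for w
    proof -
      have w: "w \<in> carrier G" "inv a \<otimes> w \<otimes> a \<in> V" using that by (auto simp: W_def)
      then have "inv v \<otimes> (inv a \<otimes> w \<otimes> a) \<otimes> v \<in> U" using V av by blast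
      then show ?thesis using c w av(3) xe by (simp add: m_assoc)
    qed
    then show "\<exists>V\<in>W ` A. \<forall>v\<in>V. x \<otimes> v \<otimes> inv x \<in> U" using av(1) by blast
  qed
qed

end

section \<open>A Birkhoff--Kakutani metric on the coset space\<close>

text \<open>The parameter \<open>a\<close> is the total already consumed, which lets the induction
  move the head of the list into it. The pivot \<open>z\<close> is the first entry that brings the
  running total to \<open>c\<close>, or the last entry if none does; what follows it must then stay
  below \<open>c\<close>.\<close>

lemma split_sum_list_half:
  fixes f :: "'a \<Rightarrow> real"
  assumes "\<And>x. 0 \<le> f x" and "xs \<noteq> []" and "0 \<le> a" "a < c" and "a + sum_list (map f xs) < 2 * c"
  shows "\<exists>ys z zs. xs = ys @ z # zs \<and> a + sum_list (map f ys) < c \<and> sum_list (map f zs) < c"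
  using assms(2-)
proof (induction xs arbitrary: a)
  case (Cons x xs)
  show ?case
  proof (cases "a + f x < c \<and> xs \<noteq> []")
    case True
    then obtain ys z zs where "xs = ys @ z # zs" "a + f x + sum_list (map f ys) < c"
        "sum_list (map f zs) < c"
      using Cons.IH[of "a + f x"] Cons.prems assms(1)[of x] by (auto simp: add.assoc)
    then show ?thesis
      by (intro exI[of _ "x # ys"] exI[of _ z] exI[of _ zs]) (simp add: add.assoc)
  next
    case False
    then have "sum_list (map f xs) < c" using Cons.prems by auto
    then show ?thesis
      using Cons.prems by (intro exI[of _ "[]"] exI[of _ x] exI[of _ xs]) simp
  qed
qed simp

text \<open>Three factors match the way Frink's argument cuts a product: an initial part, one pivot,
  a final part. The sets need not form a base at the identity, so the intersection \<open>H\<close>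
  may be nontrivial and the norm built below measures elements modulo \<open>H\<close>.\<close>

locale nhd_chain = topological_group G T for G :: "('a, 'b) monoid_scheme" (structure) and T +
  fixes V :: "nat \<Rightarrow> 'a set" and H :: "'a set"
  assumes openin_V: "openin T (V n)"
    and one_V: "\<one> \<in> V n"
    and inv_V: "x \<in> V n \<Longrightarrow> inv x \<in> V n"
    and cube_V: "x \<in> V (Suc n) \<Longrightarrow> y \<in> V (Suc n) \<Longrightarrow> z \<in> V (Suc n) \<Longrightarrow> x \<otimes> y \<otimes> z \<in> V n"
    and H_eq: "H = (\<Inter>n. V n)"
begin

lemma V_carrier: "x \<in> V n \<Longrightarrow> x \<in> carrier G"
  by (rule openin_carrier_mem[OF openin_V])

lemma mult_V: "x \<in> V (Suc n) \<Longrightarrow> y \<in> V (Suc n) \<Longrightarrow> x \<otimes> y \<in> V n"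
  using cube_V[of x n y \<one>] one_V[of "Suc n"] V_carrier[of x "Suc n"] V_carrier[of y "Suc n"] by simp

lemma decseq_V: "m \<le> n \<Longrightarrow> V n \<subseteq> V m"
proof (rule lift_Suc_antimono_le[of V])
  show "V (Suc k) \<subseteq> V k" for k
    using mult_V[of _ k \<one>] one_V V_carrier by fastforce
qed

lemma H_sub_V: "H \<subseteq> V n"
  by (auto simp: H_eq)

lemma subgroup_H: "subgroup H G"
proof
  show "H \<subseteq> carrier G" using H_sub_V V_carrier by blast
  show "x \<otimes> y \<in> H" if "x \<in> H" "y \<in> H" for x y
    using that mult_V by (simp add: H_eq)
  show "\<one> \<in> H" using one_V by (simp add: H_eq)
  show "inv x \<in> H" if "x \<in> H" for x
    using that inv_V by (simp add: H_eq)
qed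

lemma H_carrier: "h \<in> H \<Longrightarrow> h \<in> carrier G"
  by (rule subgroup.mem_carrier[OF subgroup_H])

lemma coset_map_mult_H:
  assumes "y \<in> carrier G" "h \<in> H"
  shows "coset_map G H (y \<otimes> h) = coset_map G H y"
  using assms H_carrier[of h] coset_map_eq_iff[OF subgroup_H, of y "y \<otimes> h"]
  by (simp add: mult_inv_cancel)

text \<open>The preimage of \<open>U\<close> is a union of left cosets, so translating it back by y
  gives an open set containing all of \<open>H\<close>, and countable character puts some
  \<open>V n\<close> inside. Thus the chain yields neighbourhood bases in the quotient.\<close>

lemma coset_nhd:
  assumes cc: "countable_character T H V" and U: "openin (coset_topology G T H) U"
    and y: "y \<in> carrier G" "coset_map G H y \<in> U"
  shows "\<exists>n. \<forall>v\<in>V n. coset_map G H (y \<otimes> v) \<in> U"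
proof -
  define P where "P = {z \<in> carrier G. y \<otimes> z \<in> {x \<in> topspace T. coset_map G H x \<in> U}}"
  have "openin T P"
    unfolding P_def using continuous_map_lmult[OF y(1)] U
    by (intro openin_preimage_carrier) (simp_all add: openin_coset_topology)
  moreover have "H \<subseteq> P"
    using y H_carrier coset_map_mult_H by (auto simp: P_def topspace_eq_carrier)
  ultimately obtain n where "V n \<subseteq> P"
    using cc[unfolded countable_character_def, THEN conjunct2, rule_format, of P] by auto
  then show ?thesis by (auto simp: P_def)
qed

text \<open>The value 2 keeps the infimum defined for \<open>x\<close> outside every \<open>V n\<close>.\<close>

definition gauge :: "'a \<Rightarrow> real"
  where "gauge x = Inf (insert 2 ((\<lambda>n. (1/2) ^ n) ` {n. x \<in> V n}))"

text \<open>The function \<open>gauge\<close> need not be subadditive; taking the infimum over all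
  factorizations forces the triangle inequality.\<close>

definition pnorm :: "'a \<Rightarrow> real"
  where "pnorm x = Inf ((\<lambda>xs. sum_list (map gauge xs)) `
    {xs. set xs \<subseteq> carrier G \<and> foldr (\<otimes>) xs \<one> = x})"

lemma gauge_bdd: "bdd_below (insert 2 ((\<lambda>n. (1/2 :: real) ^ n) ` {n. x \<in> V n}))"
  by (rule bdd_belowI[of _ 0]) auto

lemma gauge_nonneg: "0 \<le> gauge x"
  unfolding gauge_def by (rule cInf_greatest) auto

lemma gauge_le: "x \<in> V n \<Longrightarrow> gauge x \<le> (1/2) ^ n"
  unfolding gauge_def using gauge_bdd by (intro cInf_lower) auto

text \<open>Apart from the default value, only powers of 1/2 enter the infimum, so a strict bound by
  one power already gives membership at a later index.\<close>

lemma gauge_less_imp: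
  assumes "gauge x < (1/2) ^ n"
  shows "x \<in> V (Suc n)"
proof -
  obtain r where r: "r \<in> insert 2 ((\<lambda>n. (1/2 :: real) ^ n) ` {n. x \<in> V n})" "r < (1/2) ^ n"
    using assms unfolding gauge_def by (meson cInf_lessD insert_not_empty)
  \<comment> \<open>This excludes the default value 2 as the witness.\<close>
  moreover have "(1/2 :: real) ^ n \<le> 1" by (simp add: power_le_one)
  ultimately obtain k where k: "x \<in> V k" "(1/2 :: real) ^ k < (1/2) ^ n" by auto
  then have "n < k" by (simp add: power_strict_decreasing_iff)
  then show ?thesis using decseq_V[of "Suc n" k] k(1) by auto
qed

lemma gauge_inv: "x \<in> carrier G \<Longrightarrow> gauge (inv x) = gauge x"
proof -
  assume "x \<in> carrier G"
  then have "inv x \<in> V n \<longleftrightarrow> x \<in> V n" for n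
    using inv_V[of x n] inv_V[of "inv x" n] by auto
  then show ?thesis by (simp add: gauge_def)
qed

lemma foldr_mult_closed: "set xs \<subseteq> carrier G \<Longrightarrow> foldr (\<otimes>) xs \<one> \<in> carrier G"
  by (induction xs) auto

lemma foldr_mult_append:
  "set xs \<subseteq> carrier G \<Longrightarrow> set ys \<subseteq> carrier G \<Longrightarrow>
    foldr (\<otimes>) (xs @ ys) \<one> = foldr (\<otimes>) xs \<one> \<otimes> foldr (\<otimes>) ys \<one>"
  by (induction xs) (auto simp: m_assoc foldr_mult_closed simp del: foldr_append)

lemma foldr_mult_rev_inv:
  "set xs \<subseteq> carrier G \<Longrightarrow> foldr (\<otimes>) (rev (map (\<lambda>x. inv x) xs)) \<one> = inv (foldr (\<otimes>) xs \<one>)"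
proof (induction xs)
  case (Cons x xs)
  then have "set (rev (map (\<lambda>x. inv x) xs)) \<subseteq> carrier G" by auto
  then show ?case
    using Cons foldr_mult_append[of "rev (map (\<lambda>x. inv x) xs)" "[inv x]"]
    by (simp add: foldr_mult_closed inv_mult_group del: foldr_append)
qed simp

text \<open>Frink's chain argument: cut the chain at the element where half of the total is reached.\<close>

lemma foldr_mult_in_V:
  assumes "set xs \<subseteq> carrier G" "sum_list (map gauge xs) < (1/2) ^ n"
  shows "foldr (\<otimes>) xs \<one> \<in> V n"
  using assms
proof (induction xs arbitrary: n rule: length_induct)
  case (1 xs)
  show ?case
  proof (cases "xs = []")
    case True
    then show ?thesis using one_V by simp
  next
    case False
    have "\<exists>ys z zs. xs = ys @ z # zs \<and> 0 + sum_list (map gauge ys) < (1/2) ^ Suc n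
        \<and> sum_list (map gauge zs) < (1/2) ^ Suc n"
      using False 1 gauge_nonneg by (intro split_sum_list_half) auto
    then obtain ys z zs where xs: "xs = ys @ z # zs"
      "sum_list (map gauge ys) < (1/2) ^ Suc n" "sum_list (map gauge zs) < (1/2) ^ Suc n"
      by auto
    have sub: "set ys \<subseteq> carrier G" "set zs \<subseteq> carrier G" "z \<in> carrier G"
      using 1 xs by auto
    have "foldr (\<otimes>) ys \<one> \<in> V (Suc n)" "foldr (\<otimes>) zs \<one> \<in> V (Suc n)"
      using "1.IH" xs sub by auto
    \<comment> \<open>The pivot is bounded only by the whole total, not by half of it; the index
      gained in \<open>gauge_less_imp\<close> makes up for this.\<close>
    moreover have "z \<in> V (Suc n)"
    proof (rule gauge_less_imp)
      have "0 \<le> sum_list (map gauge ys)" "0 \<le> sum_list (map gauge zs)"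
        by (auto intro!: sum_list_nonneg gauge_nonneg)
      then show "gauge z < (1/2) ^ n" using 1 xs by simp
    qed
    moreover have "foldr (\<otimes>) xs \<one> = foldr (\<otimes>) ys \<one> \<otimes> z \<otimes> foldr (\<otimes>) zs \<one>"
      using foldr_mult_append[of ys "z # zs"] sub xs(1)
      by (simp add: foldr_mult_closed m_assoc del: foldr_append)
    ultimately show ?thesis using cube_V by simp
  qed
qed

section \<open>The subadditive symmetric norm and its kernel\<close>

lemma pnorm_bdd: "bdd_below ((\<lambda>xs. sum_list (map gauge xs)) `
    {xs. set xs \<subseteq> carrier G \<and> foldr (\<otimes>) xs \<one> = x})"
  by (rule bdd_belowI[of _ 0]) (auto intro!: sum_list_nonneg gauge_nonneg)

lemma pnorm_le: "set xs \<subseteq> carrier G \<Longrightarrow> foldr (\<otimes>) xs \<one> = x \<Longrightarrow> pnorm x \<le> sum_list (map gauge xs)"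
  unfolding pnorm_def using pnorm_bdd by (intro cInf_lower) auto

lemma pnorm_le_gauge: "x \<in> carrier G \<Longrightarrow> pnorm x \<le> gauge x"
  using pnorm_le[of "[x]" x] by simp

lemma pnorm_approx:
  assumes "x \<in> carrier G" "pnorm x < r"
  shows "\<exists>xs. set xs \<subseteq> carrier G \<and> foldr (\<otimes>) xs \<one> = x \<and> sum_list (map gauge xs) < r"
proof -
  let ?S = "{xs. set xs \<subseteq> carrier G \<and> foldr (\<otimes>) xs \<one> = x}"
  have "[x] \<in> ?S" using assms by simp
  then have "(\<lambda>xs. sum_list (map gauge xs)) ` ?S \<noteq> {}" by blast
  from cInf_lessD[OF this assms(2)[unfolded pnorm_def]] show ?thesis by auto
qed

lemma pnorm_nonneg:
  assumes "x \<in> carrier G"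
  shows "0 \<le> pnorm x"
proof (rule ccontr)
  assume "\<not> 0 \<le> pnorm x"
  then obtain xs where "sum_list (map gauge xs) < 0"
    using pnorm_approx[of x 0] assms by auto
  moreover have "0 \<le> sum_list (map gauge xs)"
    by (auto intro!: sum_list_nonneg gauge_nonneg)
  ultimately show False by simp
qed

lemma pnorm_less_imp: "x \<in> carrier G \<Longrightarrow> pnorm x < (1/2) ^ n \<Longrightarrow> x \<in> V n"
  using pnorm_approx[of x "(1/2) ^ n"] foldr_mult_in_V by auto

text \<open>Norm zero lies below every power of 1/2, so Frink's bound places x in every
  \<open>V n\<close>. Conversely, membership in every \<open>V n\<close> makes \<open>gauge\<close>
  arbitrarily small.\<close>

lemma pnorm_zero_iff: "x \<in> carrier G \<Longrightarrow> pnorm x = 0 \<longleftrightarrow> x \<in> H"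
proof
  assume "x \<in> carrier G" "pnorm x = 0"
  then show "x \<in> H" using pnorm_less_imp by (simp add: H_eq)
next
  assume x: "x \<in> carrier G" "x \<in> H"
  have "pnorm x \<le> 0"
  proof (rule field_le_epsilon)
    fix e :: real assume "0 < e"
    then obtain n where "(1/2 :: real) ^ n < e" using real_arch_pow_inv[of e "1/2"] by auto
    moreover have "pnorm x \<le> (1/2) ^ n"
      using x pnorm_le_gauge gauge_le H_sub_V by (meson order_trans subsetD)
    ultimately show "pnorm x \<le> 0 + e" by simp
  qed
  then show "pnorm x = 0" using pnorm_nonneg x by fastforce
qed

lemma pnorm_H: "h \<in> H \<Longrightarrow> pnorm h = 0"
  by (simp add: pnorm_zero_iff H_carrier)

text \<open>Concatenating nearly optimal factorizations of both factors gives a factorization of the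
  product.\<close>

lemma pnorm_mult:
  assumes "x \<in> carrier G" "y \<in> carrier G"
  shows "pnorm (x \<otimes> y) \<le> pnorm x + pnorm y"
proof (rule field_le_epsilon)
  fix e :: real assume e: "0 < e"
  obtain xs where xs: "set xs \<subseteq> carrier G" "foldr (\<otimes>) xs \<one> = x" "sum_list (map gauge xs) < pnorm x + e/2"
    using pnorm_approx[of x "pnorm x + e/2"] assms e by auto
  obtain ys where ys: "set ys \<subseteq> carrier G" "foldr (\<otimes>) ys \<one> = y" "sum_list (map gauge ys) < pnorm y + e/2"
    using pnorm_approx[of y "pnorm y + e/2"] assms e by auto
  have "pnorm (x \<otimes> y) \<le> sum_list (map gauge (xs @ ys))"
    using xs ys foldr_mult_append[of xs ys] by (intro pnorm_le) auto
  then show "pnorm (x \<otimes> y) \<le> pnorm x + pnorm y + e" using xs ys by simp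
qed

text \<open>Reversing a factorization and inverting its entries factorizes the inverse at the same
  cost.\<close>

lemma pnorm_inv_le:
  assumes "x \<in> carrier G"
  shows "pnorm (inv x) \<le> pnorm x"
proof (rule field_le_epsilon)
  fix e :: real assume e: "0 < e"
  obtain xs where xs: "set xs \<subseteq> carrier G" "foldr (\<otimes>) xs \<one> = x" "sum_list (map gauge xs) < pnorm x + e"
    using pnorm_approx[of x "pnorm x + e"] assms e by auto
  let ?ys = "rev (map (\<lambda>x. inv x) xs)"
  have "pnorm (inv x) \<le> sum_list (map gauge ?ys)"
    using xs foldr_mult_rev_inv[of xs] by (intro pnorm_le) auto
  also have "sum_list (map gauge ?ys) = sum_list (map gauge xs)"
  proof -
    have "map gauge ?ys = rev (map gauge xs)"
      using xs(1) gauge_inv by (auto simp: rev_map)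
    then show ?thesis by (simp only: sum_list_rev)
  qed
  finally show "pnorm (inv x) \<le> pnorm x + e" using xs by simp
qed

lemma pnorm_inv: "x \<in> carrier G \<Longrightarrow> pnorm (inv x) = pnorm x"
  using pnorm_inv_le[of x] pnorm_inv_le[of "inv x"] by simp

text \<open>The left-invariant pseudometric \<open>pnorm (inv x \<otimes> y)\<close> vanishes
  exactly when x and y have the same left coset. Frink's bound together with
  \<open>coset_nhd\<close> fits balls into open sets of the quotient; conversely, right
  multiplication by an element of \<open>V n\<close> moves a coset by at most the n-th power of 1/2,
  so metrically open sets have open preimages.\<close>

lemma metrizable_coset_topology:
  assumes cc: "countable_character T H V"
  shows "metrizable_space (coset_topology G T H)"
proof -
  define rep where "rep A = (SOME x. x \<in> carrier G \<and> coset_map G H x = A)" for A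
  \<comment> \<open>The absolute value, and the case distinction below, only matter off the cosets, where \<open>rep\<close> is junk.\<close>
  define D where "D A B = \<bar>pnorm (inv (rep A) \<otimes> rep B)\<bar>" for A B
  have rep: "rep A \<in> carrier G" "coset_map G H (rep A) = A" if "A \<in> lcosets H" for A
  proof -
    have "\<exists>x. x \<in> carrier G \<and> coset_map G H x = A"
      using that by (auto simp: LCOSETS_def coset_map_def)
    from someI_ex[OF this] show "rep A \<in> carrier G" "coset_map G H (rep A) = A"
      by (auto simp: rep_def)
  qed
  have D: "D A B = pnorm (inv (rep A) \<otimes> rep B)" if "A \<in> lcosets H" "B \<in> lcosets H" for A B
    using rep that pnorm_nonneg by (simp add: D_def)
  interpret D: Metric_space "lcosets H" "\<lambda>A B. if A \<in> lcosets H \<and> B \<in> lcosets H then D A B else 0"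
  proof
    fix A B C
    show "0 \<le> (if A \<in> lcosets H \<and> B \<in> lcosets H then D A B else 0)" by (simp add: D_def)
    have "D A B = D B A" if AB: "A \<in> lcosets H" "B \<in> lcosets H"
      using pnorm_inv[of "inv (rep A) \<otimes> rep B"] rep AB D by (simp add: inv_mult_group)
    then show "(if A \<in> lcosets H \<and> B \<in> lcosets H then D A B else 0) =
        (if B \<in> lcosets H \<and> A \<in> lcosets H then D B A else 0)" by auto
    assume AB: "A \<in> lcosets H" "B \<in> lcosets H"
    show "(if A \<in> lcosets H \<and> B \<in> lcosets H then D A B else 0) = 0 \<longleftrightarrow> A = B"
      using AB rep D pnorm_zero_iff coset_map_eq_iff[OF subgroup_H, of "rep A" "rep B"] by simp
    assume C: "C \<in> lcosets H"
    have "(inv (rep A) \<otimes> rep B) \<otimes> (inv (rep B) \<otimes> rep C) = inv (rep A) \<otimes> rep C"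
      using AB C rep(1) by (simp add: m_assoc mult_inv_cancel)
    then have "D A C \<le> D A B + D B C"
      using pnorm_mult[of "inv (rep A) \<otimes> rep B" "inv (rep B) \<otimes> rep C"] AB C rep(1) D by simp
    then show "(if A \<in> lcosets H \<and> C \<in> lcosets H then D A C else 0) \<le>
      (if A \<in> lcosets H \<and> B \<in> lcosets H then D A B else 0) +
      (if B \<in> lcosets H \<and> C \<in> lcosets H then D B C else 0)"
      using AB C by simp
  qed
  have ball: "D.mball A r = {B \<in> lcosets H. D A B < r}" if "A \<in> lcosets H" for A r
    using that by (auto simp: D.mball_def)
  have D_less: "D (coset_map G H y) (coset_map G H (y \<otimes> v)) \<le> (1/2) ^ n"
    if y: "y \<in> carrier G" and v: "v \<in> V n" for y v n
  proof -
    define a b where "a = rep (coset_map G H y)" and "b = rep (coset_map G H (y \<otimes> v))"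
    have vc: "v \<in> carrier G" using v V_carrier by blast
    have cos: "coset_map G H y \<in> lcosets H" "coset_map G H (y \<otimes> v) \<in> lcosets H"
      using y vc by (auto simp: LCOSETS_def coset_map_def)
    have ab: "a \<in> carrier G" "b \<in> carrier G" using rep cos by (auto simp: a_def b_def)
    have H: "inv a \<otimes> y \<in> H" "inv (y \<otimes> v) \<otimes> b \<in> H"
      using coset_map_eq_iff[OF subgroup_H, of a y] coset_map_eq_iff[OF subgroup_H, of "y \<otimes> v" b]
        rep(2)[OF cos(1)] rep(2)[OF cos(2)] ab y vc by (auto simp: a_def b_def)
    \<comment> \<open>The first and last factors lie in \<open>H\<close> and have norm zero, so the
      choice of representatives does not affect the estimate.\<close>
    have "inv a \<otimes> b = (inv a \<otimes> y) \<otimes> (v \<otimes> (inv (y \<otimes> v) \<otimes> b))"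
      using ab y vc by (simp add: inv_mult_group m_assoc mult_inv_cancel)
    then have "pnorm (inv a \<otimes> b) \<le> pnorm (inv a \<otimes> y) + (pnorm v + pnorm (inv (y \<otimes> v) \<otimes> b))"
      using pnorm_mult[of "inv a \<otimes> y" "v \<otimes> (inv (y \<otimes> v) \<otimes> b)"]
        pnorm_mult[of v "inv (y \<otimes> v) \<otimes> b"] ab y vc by simp
    also have "\<dots> = pnorm v" using H pnorm_H by simp
    also have "\<dots> \<le> (1/2) ^ n" using pnorm_le_gauge[OF vc] gauge_le[OF v] by simp
    finally show ?thesis using D cos by (simp add: a_def b_def)
  qed
  have "openin (coset_topology G T H) U \<longleftrightarrow> openin D.mtopology U" for U
  proof
    assume U: "openin (coset_topology G T H) U"
    then have Us: "U \<subseteq> lcosets H" by (simp add: openin_coset_topology)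
    show "openin D.mtopology U"
      unfolding D.openin_mtopology
    proof (intro conjI allI impI)
      show "U \<subseteq> lcosets H" by fact
      fix A assume A: "A \<in> U"
      then have r: "rep A \<in> carrier G" "coset_map G H (rep A) = A" using rep Us by auto
      then obtain n where n: "\<And>v. v \<in> V n \<Longrightarrow> coset_map G H (rep A \<otimes> v) \<in> U"
        using coset_nhd[OF cc U r(1)] A by auto
      have "D.mball A ((1/2) ^ n) \<subseteq> U"
      proof
        fix B assume "B \<in> D.mball A ((1/2) ^ n)"
        then have B: "B \<in> lcosets H" "D A B < (1/2) ^ n" using ball A Us by auto
        then have "inv (rep A) \<otimes> rep B \<in> V n"
          using pnorm_less_imp[of "inv (rep A) \<otimes> rep B" n] rep[OF B(1)] r D A Us by auto
        then have "coset_map G H (rep A \<otimes> (inv (rep A) \<otimes> rep B)) \<in> U" by (rule n)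
        then show "B \<in> U" using r rep[OF B(1)] by (simp add: mult_inv_cancel)
      qed
      then show "\<exists>r>0. D.mball A r \<subseteq> U" by (intro exI[of _ "(1/2) ^ n"]) simp
    qed
  next
    assume U: "openin D.mtopology U"
    then have Us: "U \<subseteq> lcosets H" by (simp add: D.openin_mtopology)
    have "openin T {x \<in> topspace T. coset_map G H x \<in> U}"
    proof (subst openin_subopen, intro ballI)
      fix y assume "y \<in> {x \<in> topspace T. coset_map G H x \<in> U}"
      then have y: "y \<in> carrier G" "coset_map G H y \<in> U" by (auto simp: topspace_eq_carrier)
      obtain r where r: "r > 0" "D.mball (coset_map G H y) r \<subseteq> U"
        using U y by (auto simp: D.openin_mtopology)
      obtain n where n: "(1/2 :: real) ^ n < r" using real_arch_pow_inv[of r "1/2"] r by auto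
      have "y <# V n \<subseteq> {x \<in> topspace T. coset_map G H x \<in> U}"
      proof
        fix z assume "z \<in> y <# V n"
        then obtain v where v: "v \<in> V n" "z = y \<otimes> v" by (auto simp: l_coset_def)
        have z: "z \<in> carrier G" using v y V_carrier by simp
        then have "coset_map G H z \<in> lcosets H" by (auto simp: LCOSETS_def coset_map_def)
        moreover have "D (coset_map G H y) (coset_map G H z) < r"
          using D_less[OF y(1) v(1)] v n by simp
        ultimately have "coset_map G H z \<in> D.mball (coset_map G H y) r"
          using ball y Us by auto
        then show "z \<in> {x \<in> topspace T. coset_map G H x \<in> U}"
          using r z by (auto simp: topspace_eq_carrier)
      qed
      then show "\<exists>S. openin T S \<and> y \<in> S \<and> S \<subseteq> {x \<in> topspace T. coset_map G H x \<in> U}"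
        using openin_l_coset[OF y(1) openin_V] mem_l_coset_one[OF y(1) one_V] by blast
    qed
    then show "openin (coset_topology G T H) U" using Us by (simp add: openin_coset_topology)
  qed
  then have "coset_topology G T H = D.mtopology" by (simp add: topology_eq)
  then show ?thesis using D.metrizable_space_mtopology by simp
qed

end

section \<open>Chains that are strong q-sequences\<close>

text \<open>Strong q-sequences require the n-th term to lie in the n-th set; this reindexing
  achieves it when each set is only entered eventually.\<close>

lemma strict_mono_choice:
  assumes "\<And>n :: nat. \<exists>K :: nat. \<forall>k\<ge>K. P n k"
  shows "\<exists>q. strict_mono q \<and> (\<forall>n. P n (q n))"
proof -
  have "\<exists>q. \<forall>n. P n (q n) \<and> q n < q (Suc n)"
  proof (rule dependent_nat_choice)
    show "\<exists>k. P 0 k" using assms by blast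
    fix k n
    obtain K where "\<forall>k\<ge>K. P (Suc n) k" using assms by blast
    then show "\<exists>k'. P (Suc n) k' \<and> k < k'"
      by (intro exI[of _ "max K (Suc k)"]) auto
  qed
  then show ?thesis by (auto simp: strict_mono_Suc_iff)
qed

text \<open>The individual \<open>V n\<close> need not be invariant: the index m may depend on the
  conjugating element. This still makes the intersection normal.\<close>

locale strong_q_chain = nhd_chain +
  assumes conj_V: "x \<in> carrier G \<Longrightarrow> \<exists>m. \<forall>v\<in>V m. x \<otimes> v \<otimes> inv x \<in> V n"
    and convergent_V: "(\<And>n. s n \<in> V n) \<Longrightarrow> has_convergent_subseq T s"
begin

section \<open>Properties of the subgroup H inside G\<close>

lemma normal_H: "H \<lhd> G"
proof (rule normal_invI[OF subgroup_H])
  fix x h assume x: "x \<in> carrier G" "h \<in> H"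
  have "x \<otimes> h \<otimes> inv x \<in> V n" for n
    using conj_V[OF x(1), of n] H_sub_V x(2) by blast
  then show "x \<otimes> h \<otimes> inv x \<in> H" by (simp add: H_eq)
qed

text \<open>The sets \<open>V n\<close> need not be closed, but the closure of
  \<open>V (Suc n)\<close> lies in \<open>V n\<close>: if l times v is in \<open>V (Suc n)\<close>
  with v there too, symmetry allows v to be cancelled at the cost of one index.\<close>

lemma limit_in_H:
  assumes s: "\<And>n. s n \<in> V n" and r: "strict_mono r" and l: "limitin T (s \<circ> r) l sequentially"
  shows "l \<in> H"
proof -
  have lc: "l \<in> carrier G" using l by (simp add: limitin_def topspace_eq_carrier)
  have "l \<in> V n" for n
  proof -
    have "openin T (l <# V (Suc n))" "l \<in> l <# V (Suc n)"
      using openin_l_coset[OF lc openin_V] mem_l_coset_one[OF lc one_V] by auto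
    then obtain N where N: "\<And>k. N \<le> k \<Longrightarrow> s (r k) \<in> l <# V (Suc n)"
      using l unfolding limitin_sequentially by force
    \<comment> \<open>Large enough that the term lies both in the translate around l and in
      \<open>V (Suc n)\<close>.\<close>
    define k where "k = max N (Suc n)"
    obtain v where v: "v \<in> V (Suc n)" "s (r k) = l \<otimes> v"
      using N[of k] by (auto simp: k_def l_coset_def)
    have "Suc n \<le> r k" using seq_suble[OF r, of k] by (simp add: k_def)
    then have "s (r k) \<in> V (Suc n)" using s[of "r k"] decseq_V by blast
    then have "s (r k) \<otimes> inv v \<in> V n" using v inv_V mult_V by blast
    then show ?thesis using v V_carrier[OF v(1)] lc by (simp add: m_assoc)
  qed
  then show ?thesis by (simp add: H_eq)
qed

lemma convergent_to_H:
  assumes s: "\<And>n. s n \<in> V n"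
  shows "\<exists>l r. l \<in> H \<and> strict_mono r \<and> limitin T (s \<circ> r) l sequentially"
  using convergent_V[of s, OF s] limit_in_H[of s, OF s] unfolding has_convergent_subseq_def by auto

text \<open>If no \<open>V n\<close> fitted into \<open>U\<close>, points chosen outside
  \<open>U\<close> would have a subsequence converging to a point of \<open>H\<close>, hence
  eventually inside \<open>U\<close>.\<close>

lemma countable_character_H: "countable_character T H V"
  unfolding countable_character_def
proof (intro conjI allI impI)
  show "openin T (V n)" "H \<subseteq> V n" for n using openin_V H_sub_V by auto
  fix U assume U: "openin T U \<and> H \<subseteq> U"
  show "\<exists>n. V n \<subseteq> U"
  proof (rule ccontr)
    assume "\<nexists>n. V n \<subseteq> U"
    then have "\<forall>n. \<exists>x. x \<in> V n \<and> x \<notin> U" by blast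
    then obtain s where s: "\<And>n. s n \<in> V n" "\<And>n. s n \<notin> U" by metis
    then obtain l r where "l \<in> H" "limitin T (s \<circ> r) l sequentially"
      using convergent_to_H[of s] by blast
    then obtain N where "\<And>k. N \<le> k \<Longrightarrow> s (r k) \<in> U"
      using U unfolding limitin_sequentially by force
    then show False using s(2) by blast
  qed
qed

text \<open>A point y outside \<open>V n\<close> has the neighbourhood \<open>y <# V (Suc n)\<close>
  disjoint from \<open>H\<close>, since cancelling the second factor would bring y into
  \<open>V n\<close>.\<close>

lemma closedin_H: "closedin T H"
  unfolding closedin_def
proof
  show "H \<subseteq> topspace T" using H_carrier topspace_eq_carrier by blast
  show "openin T (topspace T - H)"
  proof (subst openin_subopen, intro ballI)
    fix y assume "y \<in> topspace T - H"
    then obtain n where y: "y \<in> carrier G" "y \<notin> V n" by (auto simp: H_eq topspace_eq_carrier)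
    have "y <# V (Suc n) \<subseteq> topspace T - H"
    proof
      fix z assume "z \<in> y <# V (Suc n)"
      then obtain v where v: "v \<in> V (Suc n)" "z = y \<otimes> v" by (auto simp: l_coset_def)
      then have vc: "v \<in> carrier G" using V_carrier by blast
      have "z \<notin> H"
      proof
        assume "z \<in> H"
        then have "z \<otimes> inv v \<in> V n" using v inv_V mult_V H_sub_V by blast
        then show False using v vc y by (simp add: m_assoc)
      qed
      then show "z \<in> topspace T - H" using v vc y by (simp add: topspace_eq_carrier)
    qed
    then show "\<exists>S. openin T S \<and> y \<in> S \<and> S \<subseteq> topspace T - H"
      using openin_l_coset[OF y(1) openin_V] mem_l_coset_one[OF y(1) one_V] by blast
  qed
qed

lemma seq_compactin_H: "seq_compactin T H"
  unfolding seq_compactin_def seq_compact_space_def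
proof (intro conjI allI impI)
  show "H \<subseteq> topspace T" using closedin_H closedin_subset by blast
  fix s :: "nat \<Rightarrow> 'a" assume "range s \<subseteq> topspace (subtopology T H)"
  then have s: "\<And>n. s n \<in> H" by auto
  then obtain l r where lr: "l \<in> H" "strict_mono r" "limitin T (s \<circ> r) l sequentially"
    using convergent_to_H[of s] H_sub_V by blast
  then have "limitin (subtopology T H) (s \<circ> r) l sequentially"
    using s by (simp add: limitin_subtopology)
  then show "has_convergent_subseq (subtopology T H) s"
    using lr unfolding has_convergent_subseq_def by blast
qed

lemma strong_q_sequence_V: "y \<in> H \<Longrightarrow> strong_q_sequence T y V"
  unfolding strong_q_sequence_def using openin_V H_sub_V[THEN subsetD] convergent_V by simp

section \<open>The quotient map and the quotient space\<close>

lemma closed_map_coset_map: "closed_map T (coset_topology G T H) (coset_map G H)"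
  unfolding closed_map_def
proof (intro allI impI)
  fix C assume C: "closedin T C"
  have Cc: "C \<subseteq> carrier G" using closedin_subset[OF C] topspace_eq_carrier by simp
  let ?D = "topspace (coset_topology G T H) - coset_map G H ` C"
  have "openin T {x \<in> topspace T. coset_map G H x \<in> ?D}"
  proof (subst openin_subopen, intro ballI)
    fix y assume "y \<in> {x \<in> topspace T. coset_map G H x \<in> ?D}"
    then have y: "y \<in> carrier G" "coset_map G H y \<notin> coset_map G H ` C"
      by (auto simp: topspace_eq_carrier)
    \<comment> \<open>The coset of y misses \<open>C\<close>, so \<open>P\<close> is an open set
      around \<open>H\<close> and contains some \<open>V n\<close>. Retreating to
      \<open>V (Suc n)\<close> leaves room for a factor from \<open>H\<close>, so every coset
      meeting \<open>y <# V (Suc n)\<close> also misses \<open>C\<close>.\<close>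
    define P where "P = {z \<in> carrier G. y \<otimes> z \<in> topspace T - C}"
    have "openin T P"
      unfolding P_def using C y(1) continuous_map_lmult by (intro openin_preimage_carrier) auto
    moreover have "H \<subseteq> P"
    proof
      fix h assume h: "h \<in> H"
      then have "y \<otimes> h \<notin> C" using coset_map_mult_H[OF y(1) h] y(2) by (metis imageI)
      then show "h \<in> P" using h y H_carrier by (simp add: P_def topspace_eq_carrier)
    qed
    ultimately obtain n where n: "V n \<subseteq> P"
      using countable_character_H[unfolded countable_character_def, THEN conjunct2, rule_format, of P]
      by auto
    have "y <# V (Suc n) \<subseteq> {x \<in> topspace T. coset_map G H x \<in> ?D}"
    proof
      fix z assume "z \<in> y <# V (Suc n)"
      then obtain v where v: "v \<in> V (Suc n)" "z = y \<otimes> v" by (auto simp: l_coset_def)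
      have vc: "v \<in> carrier G" using v V_carrier by blast
      have z: "z \<in> carrier G" using v vc y by simp
      have "coset_map G H z \<notin> coset_map G H ` C"
      proof
        assume "coset_map G H z \<in> coset_map G H ` C"
        then obtain c where c: "c \<in> C" "coset_map G H z = coset_map G H c" by blast
        have cc: "c \<in> carrier G" using c Cc by blast
        have h: "inv z \<otimes> c \<in> H" using c cc z coset_map_eq_iff[OF subgroup_H] by blast
        then have "v \<otimes> (inv z \<otimes> c) \<in> V n" using v mult_V H_sub_V by blast
        then have "y \<otimes> (v \<otimes> (inv z \<otimes> c)) \<notin> C" using n by (auto simp: P_def)
        then show False
          using c(1) cc vc y v(2) by (simp add: inv_mult_group m_assoc mult_inv_cancel)
      qed
      then show "z \<in> {x \<in> topspace T. coset_map G H x \<in> ?D}"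
        using z by (auto simp: topspace_eq_carrier topspace_coset_topology LCOSETS_def coset_map_def)
    qed
    then show "\<exists>S. openin T S \<and> y \<in> S \<and> S \<subseteq> {x \<in> topspace T. coset_map G H x \<in> ?D}"
      using openin_l_coset[OF y(1) openin_V[of "Suc n"]] mem_l_coset_one[OF y(1) one_V[of "Suc n"]]
      by (intro exI[of _ "y <# V (Suc n)"] conjI)
  qed
  then have "openin (coset_topology G T H) ?D"
    by (simp add: openin_coset_topology topspace_coset_topology)
  moreover have "coset_map G H ` C \<subseteq> topspace (coset_topology G T H)"
    using Cc by (auto simp: topspace_coset_topology LCOSETS_def coset_map_def)
  ultimately show "closedin (coset_topology G T H) (coset_map G H ` C)"
    by (simp add: closedin_def)
qed

text \<open>A subsequence converges after projection, to the coset of some x. By openness of the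
  projection its terms are eventually in each \<open>x <# V n\<close>; after reindexing and
  translating back by x, the chain's convergence property gives a limit in \<open>H\<close>, so the
  original terms subconverge to a point of the same coset.\<close>

lemma seq_compactin_preimage:
  assumes F: "seq_compactin (coset_topology G T H) F"
  shows "seq_compactin T {x \<in> topspace T. coset_map G H x \<in> F}"
  unfolding seq_compactin_def seq_compact_space_def
proof (intro conjI allI impI)
  let ?Y = "coset_topology G T H" and ?P = "{x \<in> topspace T. coset_map G H x \<in> F}"
  show "?P \<subseteq> topspace T" by auto
  fix s :: "nat \<Rightarrow> 'a" assume "range s \<subseteq> topspace (subtopology T ?P)"
  then have s: "\<And>n. s n \<in> carrier G" "\<And>n. coset_map G H (s n) \<in> F"
    by (auto simp: topspace_eq_carrier)
  have "range (\<lambda>n. coset_map G H (s n)) \<subseteq> topspace (subtopology ?Y F)"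
    using s(2) F by (auto simp: seq_compactin_def)
  then have "has_convergent_subseq (subtopology ?Y F) (\<lambda>n. coset_map G H (s n))"
    using F unfolding seq_compactin_def seq_compact_space_def by blast
  then obtain A r where r: "strict_mono r" and A: "A \<in> F"
      and lim: "limitin ?Y ((\<lambda>n. coset_map G H (s n)) \<circ> r) A sequentially"
    by (auto simp: has_convergent_subseq_def limitin_subtopology)
  have "A \<in> lcosets H" using lim by (simp add: limitin_def topspace_coset_topology)
  then obtain x where x: "x \<in> carrier G" "coset_map G H x = A"
    by (auto simp: LCOSETS_def coset_map_def)
  have "\<exists>K. \<forall>k\<ge>K. s (r k) \<in> x <# V n" for n
  proof -
    \<comment> \<open>The index \<open>Suc n\<close> leaves room for the factor from
      \<open>H\<close> by which a term differs from a point of the translate.\<close>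
    have "openin ?Y (coset_map G H ` (x <# V (Suc n)))"
      using openin_coset_image[OF subgroup_H openin_l_coset[OF x(1) openin_V]] .
    moreover have "A \<in> coset_map G H ` (x <# V (Suc n))"
      using mem_l_coset_one[OF x(1) one_V] x(2) by blast
    ultimately obtain K where K: "\<And>k. K \<le> k \<Longrightarrow> coset_map G H (s (r k)) \<in> coset_map G H ` (x <# V (Suc n))"
      using lim unfolding limitin_sequentially by force
    have "s (r k) \<in> x <# V n" if k: "K \<le> k" for k
    proof -
      obtain v where v: "v \<in> V (Suc n)" "coset_map G H (x \<otimes> v) = coset_map G H (s (r k))"
        using K[OF k] by (auto simp: l_coset_def)
      have vc: "v \<in> carrier G" using v V_carrier by blast
      have "inv (x \<otimes> v) \<otimes> s (r k) \<in> H"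
        using coset_map_eq_iff[OF subgroup_H, of "x \<otimes> v" "s (r k)"] v x s vc by simp
      then have "v \<otimes> (inv (x \<otimes> v) \<otimes> s (r k)) \<in> V n" using v mult_V H_sub_V by blast
      moreover have "s (r k) = x \<otimes> (v \<otimes> (inv (x \<otimes> v) \<otimes> s (r k)))"
        using x vc s by (simp add: inv_mult_group m_assoc mult_inv_cancel)
      ultimately show ?thesis unfolding l_coset_def by blast
    qed
    then show ?thesis by blast
  qed
  from strict_mono_choice[of "\<lambda>n k. s (r k) \<in> x <# V n", OF this]
  obtain q where q: "strict_mono q" "\<forall>n. s (r (q n)) \<in> x <# V n" by auto
  then have "\<forall>n. \<exists>u. u \<in> V n \<and> s (r (q n)) = x \<otimes> u" by (auto simp: l_coset_def)
  then obtain u where u: "\<And>n. u n \<in> V n" "\<And>n. s (r (q n)) = x \<otimes> u n" by metis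
  obtain h t where t: "h \<in> H" "strict_mono t" "limitin T (u \<circ> t) h sequentially"
    using convergent_to_H[of u] u(1) by blast
  define w where "w = r \<circ> (q \<circ> t)"
  have w: "strict_mono w"
    unfolding w_def using r q(1) t(2) by (intro strict_mono_o)
  have "limitin T ((\<lambda>y. x \<otimes> y) \<circ> (u \<circ> t)) (x \<otimes> h) sequentially"
    using continuous_map_limit[OF continuous_map_lmult[OF x(1)] t(3)] .
  moreover have "(\<lambda>y. x \<otimes> y) \<circ> (u \<circ> t) = s \<circ> w" using u(2) by (auto simp: w_def)
  ultimately have "limitin T (s \<circ> w) (x \<otimes> h) sequentially" by simp
  moreover have "x \<otimes> h \<in> ?P"
    using x A t(1) H_carrier coset_map_mult_H by (simp add: topspace_eq_carrier)
  ultimately have "limitin (subtopology T ?P) (s \<circ> w) (x \<otimes> h) sequentially"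
    using s by (simp add: limitin_subtopology topspace_eq_carrier)
  then show "has_convergent_subseq (subtopology T ?P) s"
    using w unfolding has_convergent_subseq_def by blast
qed

lemma strongly_sequential_perfect_map_coset_map:
  "strongly_sequential_perfect_map T (coset_topology G T H) (coset_map G H)"
  unfolding strongly_sequential_perfect_map_def
  by (simp add: quotient_imp_continuous_map[OF quotient_map_coset_map] closed_map_coset_map
    seq_compactin_preimage)

text \<open>Writing y as a times v with a in \<open>A n\<close> and v in \<open>V n\<close> gives a
  as y times the inverse of v, so by symmetry the coset of a is as close to that of y as
  \<open>V n\<close> prescribes.\<close>

lemma separable_coset_topology:
  assumes "omega_narrow G T"
  shows "separable_space (coset_topology G T H)"
proof -
  have "\<exists>A. countable A \<and> A \<subseteq> carrier G \<and> A <#> V n = carrier G" for n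
    using assms[unfolded omega_narrow_def, rule_format, of "V n"] openin_V one_V by simp
  then obtain A where A: "\<And>n. countable (A n)" "\<And>n. A n \<subseteq> carrier G" "\<And>n. A n <#> V n = carrier G"
    by metis
  define C where "C = (\<Union>n. coset_map G H ` A n)"
  have "C \<inter> U \<noteq> {}" if U: "openin (coset_topology G T H) U" "U \<noteq> {}" for U
  proof -
    obtain y where y: "y \<in> carrier G" "coset_map G H y \<in> U"
      using U openin_subset[OF U(1)]
      by (force simp: topspace_coset_topology LCOSETS_def coset_map_def)
    obtain n where n: "\<And>v. v \<in> V n \<Longrightarrow> coset_map G H (y \<otimes> v) \<in> U"
      using coset_nhd[OF countable_character_H U(1) y] by blast
    have "y \<in> A n <#> V n" using A(3) y(1) by simp
    then obtain a v where av: "a \<in> A n" "v \<in> V n" "y = a \<otimes> v"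
      by (auto simp: set_mult_def)
    have c: "a \<in> carrier G" "v \<in> carrier G"
      using av(1) A(2) V_carrier[OF av(2)] by auto
    then have "a = y \<otimes> inv v" using av by (simp add: m_assoc)
    then have "coset_map G H a \<in> U" using n[OF inv_V[OF av(2)]] by simp
    then show ?thesis using av(1) by (auto simp: C_def)
  qed
  then have "coset_topology G T H closure_of C = topspace (coset_topology G T H)"
    by (simp add: dense_intersects_open)
  moreover have "countable C" using A(1) by (simp add: C_def)
  moreover have "C \<subseteq> topspace (coset_topology G T H)"
    using A(2) by (auto simp: C_def topspace_coset_topology LCOSETS_def coset_map_def)
  ultimately show ?thesis unfolding separable_space_def by blast
qed

end

section \<open>Construction of the chain from omega-narrowness and a strong q-sequence\<close>

lemma (in topological_group) exists_strong_q_chain: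
  assumes narrow: "omega_narrow G T" and q: "strong_q_sequence T \<one> U"
    and W: "openin T W" "\<one> \<in> W"
  shows "\<exists>V H. strong_q_chain G T V H \<and> H \<subseteq> W"
proof -
  define S where "S = {Y. openin T Y \<and> \<one> \<in> Y \<and> (\<forall>x\<in>Y. inv x \<in> Y)}"
  define cube where "cube B Y \<longleftrightarrow> (\<forall>x\<in>B. \<forall>y\<in>B. \<forall>z\<in>B. x \<otimes> y \<otimes> z \<in> Y)" for B Y
  define conj where "conj x B Y \<longleftrightarrow> (\<forall>v\<in>B. x \<otimes> v \<otimes> inv x \<in> Y)" for x B Y
  have cubeE: "\<exists>Y\<in>S. Y \<subseteq> X \<and> cube Y X" if "openin T X" "\<one> \<in> X" for X
    using symmetric_nhd_cube[OF that] by (auto simp: S_def cube_def)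
  \<comment> \<open>One member serves for cubing. For conjugation by all group elements countably
    many suffice by omega-narrowness, each shrunk to a symmetric one.\<close>
  have "\<exists>\<gamma>. countable \<gamma> \<and> \<gamma> \<subseteq> S \<and> (\<exists>B\<in>\<gamma>. cube B Y) \<and> (\<forall>x\<in>carrier G. \<exists>B\<in>\<gamma>. conj x B Y)"
    if Y: "Y \<in> S" for Y
  proof -
    have Yo: "openin T Y" "\<one> \<in> Y" using Y by (auto simp: S_def)
    obtain \<gamma> where \<gamma>: "countable \<gamma>" "\<forall>V\<in>\<gamma>. openin T V \<and> \<one> \<in> V"
      "\<forall>x\<in>carrier G. \<exists>V\<in>\<gamma>. \<forall>v\<in>V. x \<otimes> v \<otimes> inv x \<in> Y"
      using omega_narrow_countable_conjugates[OF narrow Yo] by auto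
    have "\<forall>V\<in>\<gamma>. \<exists>B. B \<in> S \<and> B \<subseteq> V" using \<gamma>(2) cubeE by blast
    then obtain b where b: "\<And>V. V \<in> \<gamma> \<Longrightarrow> b V \<in> S" "\<And>V. V \<in> \<gamma> \<Longrightarrow> b V \<subseteq> V" by metis
    obtain B where B: "B \<in> S" "cube B Y" using cubeE[OF Yo] by blast
    have "\<exists>B'\<in>insert B (b ` \<gamma>). conj x B' Y" if x: "x \<in> carrier G" for x
    proof -
      obtain V where "V \<in> \<gamma>" "\<forall>v\<in>V. x \<otimes> v \<otimes> inv x \<in> Y" using \<gamma>(3) x by blast
      then have "conj x (b V) Y" using b(2) by (auto simp: conj_def)
      then show ?thesis using \<open>V \<in> \<gamma>\<close> by blast
    qed
    then show ?thesis
      using \<gamma>(1) b(1) B by (intro exI[of _ "insert B (b ` \<gamma>)"]) auto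
  qed
  then obtain g where g: "\<And>Y. Y \<in> S \<Longrightarrow> countable (g Y)" "\<And>Y. Y \<in> S \<Longrightarrow> g Y \<subseteq> S"
      "\<And>Y. Y \<in> S \<Longrightarrow> \<exists>B\<in>g Y. cube B Y"
      "\<And>Y x. Y \<in> S \<Longrightarrow> x \<in> carrier G \<Longrightarrow> \<exists>B\<in>g Y. conj x B Y"
    by metis
  obtain W' where W': "W' \<in> S" "W' \<subseteq> W" using cubeE[OF W] by blast
  have "\<forall>n. \<exists>Y. Y \<in> S \<and> Y \<subseteq> U n"
    using q cubeE unfolding strong_q_sequence_def by blast
  then obtain U' where U': "\<And>n. U' n \<in> S" "\<And>n. U' n \<subseteq> U n" by metis
  \<comment> \<open>Iterating \<open>g\<close> closes the starting family: after countably many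
    rounds every witness required by a member is itself a member, and the union stays countable.
    \<open>W'\<close> will put \<open>H\<close> inside \<open>W\<close>, and the \<open>U'\<close>
    will give convergence.\<close>
  define F where "F = rec_nat (insert W' (range U')) (\<lambda>_ A. \<Union>(g ` A))"
  have F0: "F 0 = insert W' (range U')" and FS: "F (Suc k) = \<Union>(g ` F k)" for k
    by (simp_all add: F_def)
  have F: "countable (F k) \<and> F k \<subseteq> S" for k
  proof (induction k)
    case 0
    show ?case using W' U' by (auto simp: F0)
  next
    case (Suc k)
    then show ?case unfolding FS using g(1,2) by (auto intro!: countable_UN)
  qed
  define Fam where "Fam = (\<Union>k. F k)"
  define f where "f = from_nat_into Fam"
  have "Fam \<noteq> {}" "countable Fam" using F0 F by (auto simp: Fam_def)
  then have f: "range f = Fam" by (simp add: f_def range_from_nat_into)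
  have FamS: "Fam \<subseteq> S" using F by (auto simp: Fam_def)
  have gFam: "g Y \<subseteq> Fam" if "Y \<in> Fam" for Y
    using that FS unfolding Fam_def by blast
  \<comment> \<open>Finite intersections turn the enumeration into a decreasing sequence that still
    gets inside every member of \<open>Fam\<close>.\<close>
  define Z where "Z n = (\<Inter>i\<le>n. f i)" for n :: nat
  have fS: "f i \<in> S" for i using f FamS by blast
  have ZS: "Z n \<in> S" for n
    using fS by (auto simp: Z_def S_def intro!: openin_INT2)
  have Zdec: "Z n \<subseteq> Z m" if "m \<le> n" for m n using that by (auto simp: Z_def)
  have ZFam: "\<exists>n. Z n \<subseteq> Y" if Y: "Y \<in> Fam" for Y
  proof -
    obtain n where "f n = Y" using Y f by blast
    then have "Z n \<subseteq> Y" by (auto simp: Z_def)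
    then show ?thesis by blast
  qed
  \<comment> \<open>\<open>R\<close> stands for \<open>cube\<close> or \<open>conj x\<close>. Since
    it survives shrinking its first argument, the largest of the finitely many indices works for all
    i up to n.\<close>
  have fin: "\<exists>m. \<forall>i\<le>n. R (Z m) (f i)"
    if R: "\<And>Y. Y \<in> Fam \<Longrightarrow> \<exists>B\<in>Fam. R B Y" and mono: "\<And>A B Y. A \<subseteq> B \<Longrightarrow> R B Y \<Longrightarrow> R A Y"
    for R :: "'a set \<Rightarrow> 'a set \<Rightarrow> bool" and n :: nat
  proof -
    have "\<exists>j. R (Z j) (f i)" for i
    proof -
      obtain B where "B \<in> Fam" "R B (f i)" using R f by blast
      then show ?thesis using ZFam mono by blast
    qed
    then obtain j where j: "\<And>i. R (Z (j i)) (f i)" by metis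
    have "R (Z (Max (j ` {..n}))) (f i)" if "i \<le> n" for i
      using mono[OF Zdec j] that by simp
    then show ?thesis by blast
  qed
  have Zcube: "\<exists>m. cube (Z m) (Z n)" for n
  proof -
    have "\<exists>m. \<forall>i\<le>n. cube (Z m) (f i)"
    proof (rule fin)
      show "\<exists>B\<in>Fam. cube B Y" if "Y \<in> Fam" for Y using g(3) gFam[OF that] FamS that by blast
      show "cube A Y" if "A \<subseteq> B" "cube B Y" for A B Y using that by (auto simp: cube_def)
    qed
    moreover have "cube B (Z n)" if "\<forall>i\<le>n. cube B (f i)" for B
      using that by (auto simp: cube_def Z_def)
    ultimately show ?thesis by blast
  qed
  have Zconj: "\<exists>m. conj x (Z m) (Z n)" if x: "x \<in> carrier G" for n x
  proof -
    have "\<exists>m. \<forall>i\<le>n. conj x (Z m) (f i)"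
    proof (rule fin)
      show "\<exists>B\<in>Fam. conj x B Y" if "Y \<in> Fam" for Y using g(4)[of Y x] x gFam[OF that] FamS that by blast
      show "conj x A Y" if "A \<subseteq> B" "conj x B Y" for A B Y using that by (auto simp: conj_def)
    qed
    moreover have "conj x B (Z n)" if "\<forall>i\<le>n. conj x B (f i)" for B
      using that by (auto simp: conj_def Z_def)
    ultimately show ?thesis by blast
  qed
  \<comment> \<open>Thinning makes the cube inclusion hold between consecutive members, and strict
    growth of \<open>p\<close> keeps \<open>V n\<close> inside \<open>Z n\<close>.
    \<open>True\<close> fills the pointwise predicate of the choice rule.\<close>
  have "\<exists>p. \<forall>n. True \<and> p n < p (Suc n) \<and> cube (Z (p (Suc n))) (Z (p n))"
  proof (rule dependent_nat_choice)
    fix k n :: nat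
    obtain m where "cube (Z m) (Z k)" using Zcube by blast
    moreover have "Z (max m (Suc k)) \<subseteq> Z m" by (intro Zdec) simp
    ultimately have "cube (Z (max m (Suc k))) (Z k)" unfolding cube_def by blast
    then show "\<exists>m. True \<and> k < m \<and> cube (Z m) (Z k)"
      by (intro exI[of _ "max m (Suc k)"]) simp
  qed simp
  then obtain p where p: "strict_mono p" "\<And>n. cube (Z (p (Suc n))) (Z (p n))"
    by (auto simp: strict_mono_Suc_iff)
  define V where "V n = Z (p n)" for n
  have VZ: "V n \<subseteq> Z n" for n
    unfolding V_def using Zdec seq_suble[OF p(1)] by blast
  have VFam: "\<exists>n. \<forall>k\<ge>n. V k \<subseteq> Y" if "Y \<in> Fam" for Y
    using ZFam[OF that] VZ Zdec by (meson order_trans)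
  have "strong_q_chain G T V (\<Inter>n. V n)"
  proof
    show "openin T (V n)" "\<one> \<in> V n" for n using ZS by (auto simp: V_def S_def)
    show "inv x \<in> V n" if "x \<in> V n" for x n using ZS that by (auto simp: V_def S_def)
    show "x \<otimes> y \<otimes> z \<in> V n" if "x \<in> V (Suc n)" "y \<in> V (Suc n)" "z \<in> V (Suc n)" for x y z n
      using p(2) that by (auto simp: V_def cube_def)
    show "\<exists>m. \<forall>v\<in>V m. x \<otimes> v \<otimes> inv x \<in> V n" if x: "x \<in> carrier G" for x n
    proof -
      obtain m where "conj x (Z m) (V n)" using Zconj[OF x] unfolding V_def by blast
      then show ?thesis using VZ by (auto simp: conj_def)
    qed
    fix s :: "nat \<Rightarrow> 'a" assume s: "\<And>n. s n \<in> V n"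
    \<comment> \<open>The chain enters each \<open>U n\<close> only eventually, so the strong
      q-property is applied to the subsequence \<open>s \<circ> t\<close>.\<close>
    have "\<exists>K. \<forall>k\<ge>K. V k \<subseteq> U n" for n
    proof -
      have "U' n \<in> Fam" unfolding Fam_def using F0 by blast
      then show ?thesis using VFam U'(2) by (meson order_trans)
    qed
    from strict_mono_choice[of "\<lambda>n k. V k \<subseteq> U n", OF this]
    obtain t where t: "strict_mono t" "\<And>n. V (t n) \<subseteq> U n" by auto
    then have "\<forall>n. (s \<circ> t) n \<in> U n" using s by auto
    then obtain l r where "strict_mono r" "limitin T ((s \<circ> t) \<circ> r) l sequentially"
      using q unfolding strong_q_sequence_def has_convergent_subseq_def by blast
    then show "has_convergent_subseq T s"
      unfolding has_convergent_subseq_def using t(1)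
      by (intro exI[of _ l] exI[of _ "t \<circ> r"]) (auto simp: o_assoc intro: strict_mono_o)
  qed simp
  moreover have "(\<Inter>n. V n) \<subseteq> W"
  proof -
    have "W' \<in> Fam" unfolding Fam_def using F0 by blast
    then obtain n where "V n \<subseteq> W'" using VFam by blast
    then show ?thesis using W'(2) by blast
  qed
  ultimately show ?thesis by blast
qed

section \<open>Assembly of the equivalence\<close>

theorem corollary2p11:
  fixes G :: "('a, 'b) monoid_scheme" and T :: "'a topology"
  assumes "topological_group G T" and "Hausdorff_space T"
  shows "omega_narrow G T \<and> strong_q_space T \<longleftrightarrow>
    (\<forall>W. openin T W \<and> \<one>\<^bsub>G\<^esub> \<in> W \<longrightarrow>
      (\<exists>H V. H \<lhd> G \<and> closedin T H \<and> seq_compactin T H \<and>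
        countable_character T H V \<and>
        H \<subseteq> W \<and>
        (\<forall>y \<in> H. strong_q_sequence T y V) \<and>
        strongly_sequential_perfect_map T (coset_topology G T H) (coset_map G H) \<and>
        separable_space (coset_topology G T H) \<and>
        metrizable_space (coset_topology G T H)))"
    (is "_ \<longleftrightarrow> (\<forall>W. ?nhd W \<longrightarrow> ?R W)")
proof -
  interpret topological_group G T by fact
  show ?thesis
  proof
    assume L: "omega_narrow G T \<and> strong_q_space T"
    then obtain U where U: "strong_q_sequence T \<one>\<^bsub>G\<^esub> U"
      by (auto simp: strong_q_space_def strong_q_point_def topspace_eq_carrier)
    show "\<forall>W. ?nhd W \<longrightarrow> ?R W"
    proof (intro allI impI)
      fix W assume "?nhd W"
      then obtain V H where VH: "strong_q_chain G T V H" "H \<subseteq> W"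
        using exists_strong_q_chain[of U W] L U by blast
      interpret strong_q_chain G T V H by (rule VH(1))
      show "?R W"
        using VH(2) L
        by (intro exI[of _ H] exI[of _ V])
          (simp add: normal_H closedin_H seq_compactin_H countable_character_H strong_q_sequence_V
            strongly_sequential_perfect_map_coset_map separable_coset_topology
            metrizable_coset_topology)
    qed
  next
    assume R: "\<forall>W. ?nhd W \<longrightarrow> ?R W"
    have "omega_narrow G T"
    proof (rule omega_narrow_if_quotients_separable)
      fix W assume "openin T W" "\<one>\<^bsub>G\<^esub> \<in> W"
      then obtain H where "H \<lhd> G" "H \<subseteq> W" "separable_space (coset_topology G T H)"
        using R by meson
      then show "\<exists>H. subgroup H G \<and> H \<subseteq> W \<and> separable_space (coset_topology G T H)"
        using normal_imp_subgroup by blast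
    qed
    moreover have "strong_q_space T"
    proof -
      \<comment> \<open>The whole space serves as the neighbourhood, since only a strong q-sequence
        at the identity is wanted here; translation handles the other points.\<close>
      have "\<one>\<^bsub>G\<^esub> \<in> topspace T" by (simp add: topspace_eq_carrier)
      then have "?nhd (topspace T)" by simp
      then obtain H V where HV: "H \<lhd> G" "\<forall>y\<in>H. strong_q_sequence T y V"
        using R by meson
      then have "strong_q_sequence T \<one>\<^bsub>G\<^esub> V"
        using subgroup.one_closed normal_imp_subgroup by blast
      then show ?thesis
        unfolding strong_q_space_def strong_q_point_def topspace_eq_carrier
        using strong_q_sequence_translate by blast
    qed
    ultimately show "omega_narrow G T \<and> strong_q_space T" by blast
  qed
qed

end
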